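(* For every $E\in\mathcal{M}_{\mathrm f}(\mathbb{R}^d)$, $\hat H^0_R(E)$ is monotonically non-increasing with respect to $R\in(0,+\infty)$ and $$\lim_{R\to+\infty}\hat H^0_R(E)=H^0_1(E)+J^0_1(E)=:\hat H^0(E).$$ Finally, $\hat H^0$ is the $\Gamma$-limit of the functionals $\hat H^0_R$ as $R\to+\infty$ with respect to the strong $L^1$ convergence of characteristic functions.
   Context: Let $d\ge1$, let $|E|$ denote Lebesgue measure in $\mathbb{R}^d$, $\omega_d$ the measure of the unit ball, $B_\rho(x)$ the ball of radius $\rho$ and center $x$, and $\chi_E$ the characteristic function of $E$. $\mathcal{M}_{\mathrm f}(\mathbb{R}^d)$ is the family of measurable sets $E\subset\mathbb{R}^d$ with $|E|<+\infty$. For $R>0$ and $E\in\mathcal{M}_{\mathrm f}(\mathbb{R}^d)$ set $$H^0_R(E):=\int_E\int_{B_R(x)\setminus E}\frac{1}{|x-y|^{d}}\,dy\,dx,\qquad J^0_R(E):=-\int_E\int_{E\setminus B_R(x)}\frac{1}{|x-y|^{d}}\,dy\,dx,$$ $$\hat H^0_R(E):=H^0_R(E)-d\omega_d\log R\,|E|,$$ where $H^0_R(E)$ and $\hat H^0_R(E)$ may equal $+\infty$. $\Gamma$-convergence as $R\to+\infty$ is understood on $\mathcal{M}_{\mathrm f}(\mathbb{R}^d)$, with convergence $E_n\to E$ meaning $\chi_{E_n}\to\chi_E$ in $L^1(\mathbb{R}^d)$: for every sequence $R_n\to+\infty$, (liminf) $\hat H^0(E)\le\liminf_n\hat H^0_{R_n}(E_n)$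 whenever $E_n\to E$, and (limsup) for every $E$ there is $E_n\to E$ with $\hat H^0(E)\ge\limsup_n\hat H^0_{R_n}(E_n)$. *)

theory Defs
  imports "HOL-Analysis.Analysis"
begin

text \<open>
  The space \<open>\<real>\<^sup>d\<close> is an arbitrary Euclidean space \<open>'a\<close> with \<open>d = DIM('a) \<ge> 1\<close>; the family of
  measurable sets of finite measure is \<open>lmeasurable\<close>. The functionals take values in \<open>ereal\<close>,
  since \<open>H0\<close> may be \<open>\<infinity>\<close>.
\<close>

definition H0 :: "real \<Rightarrow> 'a::euclidean_space set \<Rightarrow> ereal" where
  "H0 R E = enn2ereal (\<integral>\<^sup>+x\<in>E. (\<integral>\<^sup>+y\<in>ball x R - E. ennreal (1 / norm (x - y) ^ DIM('a)) \<partial>lebesgue) \<partial>lebesgue)"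

definition J0 :: "real \<Rightarrow> 'a::euclidean_space set \<Rightarrow> ereal" where
  "J0 R E = - enn2ereal (\<integral>\<^sup>+x\<in>E. (\<integral>\<^sup>+y\<in>E - ball x R. ennreal (1 / norm (x - y) ^ DIM('a)) \<partial>lebesgue) \<partial>lebesgue)"

definition H0_hat :: "real \<Rightarrow> 'a::euclidean_space set \<Rightarrow> ereal" where
  "H0_hat R E = H0 R E -
     ereal (real DIM('a) * measure lebesgue (ball (0::'a) 1) * ln R * measure lebesgue E)"

definition H0_hat_lim :: "'a::euclidean_space set \<Rightarrow> ereal" where
  "H0_hat_lim E = H0 1 E + J0 1 E"

definition char_L1_conv :: "(nat \<Rightarrow> 'a::euclidean_space set) \<Rightarrow> 'a set \<Rightarrow> bool" where
  "char_L1_conv En E \<longleftrightarrow>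
     (\<lambda>n. \<integral>\<^sup>+x. ennreal \<bar>indicat_real (En n) x - indicat_real E x\<bar> \<partial>lebesgue) \<longlonglongrightarrow> 0"

text \<open>
  Sequential \<open>\<Gamma>\<close>-convergence, as \<open>R \<rightarrow> \<infinity>\<close>, of functionals \<open>F R\<close> (\<open>R > 0\<close>) to \<open>G\<close> on a
  space \<open>X\<close> equipped with the notion \<open>conv\<close> of sequential convergence.
\<close>

definition Gamma_limit_at_top ::
  "'b set \<Rightarrow> ((nat \<Rightarrow> 'b) \<Rightarrow> 'b \<Rightarrow> bool) \<Rightarrow> (real \<Rightarrow> 'b \<Rightarrow> ereal) \<Rightarrow> ('b \<Rightarrow> ereal) \<Rightarrow> bool" where
  "Gamma_limit_at_top X conv F G \<longleftrightarrow>
     (\<forall>r::nat \<Rightarrow> real. (\<forall>n. 0 < r n) \<and> filterlim r at_top sequentially \<longrightarrow>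
        (\<forall>u x. (\<forall>n. u n \<in> X) \<and> x \<in> X \<and> conv u x \<longrightarrow> G x \<le> liminf (\<lambda>n. F (r n) (u n))) \<and>
        (\<forall>x\<in>X. \<exists>u. (\<forall>n. u n \<in> X) \<and> conv u x \<and> limsup (\<lambda>n. F (r n) (u n)) \<le> G x))"

end

theory Submission
  imports Defs
begin

text \<open>
  Write \<open>I D A B\<close> for the double integral of \<open>|x - y|\<^sup>-\<^sup>d\<close> over \<open>x \<in> A\<close>, \<open>y \<in> B\<close> with
  \<open>|x - y| \<in> D\<close>. The kernel integrates to \<open>d \<omega>\<^sub>d log (R / r)\<close> over every shell \<open>r \<le> |x - y| < R\<close>,
  so the logarithmic renormalisation turns the shell contribution of the complement of \<open>E\<close> into
  minus that of \<open>E\<close>: \<open>H0_hat r E = H0_hat R E + I [r,R) E E\<close>. This gives monotonicity, and for \<open>R \<ge> 1\<close> it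
  gives \<open>H0_hat R E = H0_hat_lim E + I [R,\<infinity>) E E\<close>, whose last term is at most \<open>|E|\<^sup>2 / R\<^sup>d\<close>. Constant
  sequences are therefore recovery sequences, and \<open>H0_hat R \<ge> H0_hat_lim\<close> reduces the liminf
  inequality to lower semicontinuity of \<open>H0_hat_lim\<close>. That functional is the supremum over
  \<open>\<epsilon>\<close> of the truncations \<open>I [\<epsilon>,1) E (-E) - I [1,\<infinity>) E E\<close>, which are continuous because the
  truncated kernels are bounded.
\<close>

section \<open>Double integrals of the kernel over prescribed distances\<close>

text \<open>By the convention \<open>1 / 0 = 0\<close> the kernel vanishes on the diagonal. The
  distance constraint sits in the kernel rather than in the domain of integration, so that balls,
  shells and tails are all choices of \<open>D\<close>.\<close>

definition kernel :: "real set \<Rightarrow> 'a::euclidean_space \<Rightarrow> 'a \<Rightarrow> ennreal" where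
  "kernel D x y = ennreal (1 / norm (x - y) ^ DIM('a)) * indicator D (dist x y)"

definition interaction :: "real set \<Rightarrow> 'a::euclidean_space set \<Rightarrow> 'a set \<Rightarrow> ennreal" where
  "interaction D A B = (\<integral>\<^sup>+x\<in>A. (\<integral>\<^sup>+y\<in>B. kernel D x y \<partial>lebesgue) \<partial>lebesgue)"

lemma H0_eq_interaction:
  "H0 R (E::'a::euclidean_space set) = enn2ereal (interaction {..<R} E (- E))"
proof -
  have "(\<integral>\<^sup>+y\<in>ball x R - E. ennreal (1 / norm (x - y) ^ DIM('a)) \<partial>lebesgue) =
      (\<integral>\<^sup>+y\<in>- E. kernel {..<R} x y \<partial>lebesgue)" for x
    by (intro nn_integral_cong) (auto simp: kernel_def indicator_def)
  then show ?thesis by (simp add: H0_def interaction_def)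
qed

lemma J0_eq_interaction:
  "J0 R (E::'a::euclidean_space set) = - enn2ereal (interaction {R..} E E)"
proof -
  have "(\<integral>\<^sup>+y\<in>E - ball x R. ennreal (1 / norm (x - y) ^ DIM('a)) \<partial>lebesgue) =
      (\<integral>\<^sup>+y\<in>E. kernel {R..} x y \<partial>lebesgue)" for x
    by (intro nn_integral_cong) (auto simp: kernel_def indicator_def)
  then show ?thesis by (simp add: J0_def interaction_def)
qed

section \<open>Measurability of the kernel and of the inner integral\<close>

lemma borel_measurable_kernel_pair [measurable]:
  assumes [measurable]: "D \<in> sets borel"
  shows "(\<lambda>(x::'a::euclidean_space, y). kernel D x y) \<in> borel_measurable (borel \<Otimes>\<^sub>M borel)"
  unfolding kernel_def by measurable

lemma borel_measurable_kernel:
  assumes D: "D \<in> sets borel"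
  shows "kernel D (x::'a::euclidean_space) \<in> borel_measurable lebesgue"
proof -
  have "kernel D x \<in> borel_measurable lborel"
    using measurable_Pair2[OF borel_measurable_kernel_pair[OF D], of x] by simp
  then show ?thesis by (rule measurable_completion)
qed

text \<open>Replacing \<open>B\<close> by a Borel set that differs from it by a null set makes Tonelli available.\<close>

lemma borel_measurable_inner [measurable]:
  assumes D [measurable]: "D \<in> sets borel" and B: "B \<in> sets lebesgue"
  shows "(\<lambda>x::'a::euclidean_space. \<integral>\<^sup>+y\<in>B. kernel D x y \<partial>lebesgue) \<in> borel_measurable lebesgue"
proof -
  obtain S N N' where B_eq: "B = S \<union> N" and N: "N \<subseteq> N'" "N' \<in> null_sets lborel"
    and S: "S \<in> sets lborel"
    using sets_completionE[OF B] by metis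
  have [measurable]: "S \<in> sets borel" using S by simp
  have "(\<integral>\<^sup>+y\<in>B. kernel D x y \<partial>lebesgue) = (\<integral>\<^sup>+y\<in>S. kernel D x y \<partial>lborel)" for x
    unfolding nn_integral_completion
    by (intro nn_integral_cong_AE AE_I'[OF N(2)]) (use N(1) B_eq in \<open>auto simp: indicator_def\<close>)
  moreover have "(\<lambda>x. \<integral>\<^sup>+y\<in>S. kernel D x y \<partial>lborel) \<in> borel_measurable lborel"
    by measurable
  ultimately show ?thesis by (simp add: measurable_completion)
qed

section \<open>Additivity, bounds and exhaustion by distances\<close>

lemma interaction_Un_left:
  assumes "D \<in> sets borel" "A \<in> sets lebesgue" "A' \<in> sets lebesgue" "B \<in> sets lebesgue"
    and disj: "A \<inter> A' = {}"
  shows "interaction D (A \<union> A') B = interaction D A B + interaction D A' B"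
proof -
  note [measurable] = assms(2,3) borel_measurable_inner[OF assms(1,4)]
  show ?thesis
    unfolding interaction_def
    by (subst nn_integral_add[symmetric])
      (measurable, use disj in \<open>auto intro!: nn_integral_cong simp: indicator_def\<close>)
qed

lemma interaction_Un_right:
  assumes "D \<in> sets borel" "A \<in> sets lebesgue" "B \<in> sets lebesgue" "B' \<in> sets lebesgue"
    and disj: "B \<inter> B' = {}"
  shows "interaction D A (B \<union> B') = interaction D A B + interaction D A B'"
proof -
  note [measurable] = assms(2,3,4) borel_measurable_kernel[OF assms(1)]
    borel_measurable_inner[OF assms(1,3)] borel_measurable_inner[OF assms(1,4)]
  have "(\<integral>\<^sup>+y\<in>B \<union> B'. kernel D x y \<partial>lebesgue) =
      (\<integral>\<^sup>+y\<in>B. kernel D x y \<partial>lebesgue) + (\<integral>\<^sup>+y\<in>B'. kernel D x y \<partial>lebesgue)" for x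
    by (subst nn_integral_add[symmetric])
      (measurable, use disj in \<open>auto intro!: nn_integral_cong simp: indicator_def\<close>)
  then show ?thesis
    unfolding interaction_def
    by (subst nn_integral_add[symmetric]) (simp_all add: distrib_right)
qed

lemma interaction_Un_distance:
  assumes "D \<in> sets borel" "D' \<in> sets borel" "A \<in> sets lebesgue" "B \<in> sets lebesgue"
    and disj: "D \<inter> D' = {}"
  shows "interaction (D \<union> D') A B = interaction D A B + interaction D' A B"
proof -
  note [measurable] = assms(3,4) borel_measurable_kernel[OF assms(1)] borel_measurable_kernel[OF assms(2)]
    borel_measurable_inner[OF assms(1,4)] borel_measurable_inner[OF assms(2,4)]
  have "(\<integral>\<^sup>+y\<in>B. kernel (D \<union> D') x y \<partial>lebesgue) =
      (\<integral>\<^sup>+y\<in>B. kernel D x y \<partial>lebesgue) + (\<integral>\<^sup>+y\<in>B. kernel D' x y \<partial>lebesgue)" for x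
    by (subst nn_integral_add[symmetric])
      (measurable, use disj in \<open>auto intro!: nn_integral_cong simp: indicator_def kernel_def\<close>)
  then show ?thesis
    unfolding interaction_def
    by (subst nn_integral_add[symmetric]) (simp_all add: distrib_right)
qed

lemma interaction_mono:
  assumes "D \<subseteq> D'" "A \<subseteq> A'" "B \<subseteq> B'"
  shows "interaction D A B \<le> interaction D' A' B'"
  unfolding interaction_def kernel_def
  using assms by (intro nn_integral_mono mult_mono) (auto simp: indicator_def)

text \<open>At distances at least \<open>r\<close> the kernel is at most
  \<open>1 / r ^ DIM('a)\<close>. This is the boundedness that makes truncated interactions stable
  under small changes of the sets.\<close>

lemma interaction_le:
  assumes r: "0 < r" and D: "D \<subseteq> {r..}" and A: "A \<in> sets lebesgue" and B: "B \<in> sets lebesgue"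
  shows "interaction D A (B::'a::euclidean_space set) \<le>
    ennreal (1 / r ^ DIM('a)) * emeasure lebesgue A * emeasure lebesgue B"
proof -
  have k: "kernel D x y \<le> ennreal (1 / r ^ DIM('a))" for x y :: 'a
    using r D by (auto simp: kernel_def indicator_def dist_norm intro!: ennreal_leI divide_left_mono
        power_mono zero_less_power mult_pos_pos dest!: subsetD)
  have "interaction D A B \<le>
      (\<integral>\<^sup>+x\<in>A. (\<integral>\<^sup>+y\<in>B. ennreal (1 / r ^ DIM('a)) \<partial>lebesgue) \<partial>lebesgue)"
    unfolding interaction_def by (intro nn_integral_mono mult_mono k) auto
  also have "\<dots> = ennreal (1 / r ^ DIM('a)) * emeasure lebesgue A * emeasure lebesgue B"
    using A B
    by (simp add: nn_integral_cmult_indicator nn_integral_cmult del: emeasure_completion) (simp add: mult_ac)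
  finally show ?thesis .
qed

text \<open>Monotone convergence is applied twice, to the inner and then to the outer integral.
  Pointwise, the truncated kernels are eventually constant: a distance in some \<open>D m\<close>
  stays in all later ones.\<close>

lemma interaction_distance_SUP:
  assumes D: "\<And>n. D n \<in> sets borel" and inc: "incseq D"
    and A: "A \<in> sets lebesgue" and B: "B \<in> sets lebesgue"
  shows "interaction (\<Union>n. D n) A B = (SUP n. interaction (D n) A B)"
proof -
  note [measurable] = A B borel_measurable_kernel[OF D] borel_measurable_inner[OF D B]
  have inc': "incseq (\<lambda>n. kernel (D n) x y * indicator B y)" for x y
    using inc by (auto simp: kernel_def incseq_def indicator_def le_fun_def dest!: subsetD)
  have kSUP: "kernel (\<Union>n. D n) x y * indicator B y = (SUP n. kernel (D n) x y * indicator B y)" for x y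
  proof (intro LIMSEQ_unique[OF _ LIMSEQ_SUP[OF inc']])
    show "(\<lambda>n. kernel (D n) x y * indicator B y) \<longlonglongrightarrow> kernel (\<Union>n. D n) x y * indicator B y"
    proof (cases "dist x y \<in> (\<Union>n. D n)")
      case True
      then obtain m where "dist x y \<in> D m" by auto
      then have "\<forall>n\<ge>m. dist x y \<in> D n" using inc by (auto simp: incseq_def)
      then have "eventually (\<lambda>n. kernel (D n) x y * indicator B y
          = kernel (\<Union>n. D n) x y * indicator B y) sequentially"
        using True by (auto simp: eventually_sequentially kernel_def indicator_def)
      then show ?thesis by (rule tendsto_eventually)
    qed (simp add: kernel_def)
  qed
  have inner: "(\<integral>\<^sup>+y\<in>B. kernel (\<Union>n. D n) x y \<partial>lebesgue) = (SUP n. \<integral>\<^sup>+y\<in>B. kernel (D n) x y \<partial>lebesgue)" for x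
    unfolding kSUP
    by (rule nn_integral_monotone_convergence_SUP)
      (use inc' in \<open>auto simp: incseq_def le_fun_def\<close>)
  have mono: "incseq (\<lambda>n x. (\<integral>\<^sup>+y\<in>B. kernel (D n) x y \<partial>lebesgue) * indicator A x)"
    unfolding incseq_def le_fun_def
    by (intro allI impI mult_right_mono nn_integral_mono incseqD[OF inc']) simp_all
  show ?thesis
    unfolding interaction_def inner SUP_mult_right_ennreal
    by (rule nn_integral_monotone_convergence_SUP[OF mono]) measurable
qed

text \<open>
  Layer cake: \<open>1 / s\<^sup>d\<close> is the integral of \<open>d / t\<^sup>d\<^sup>+\<^sup>1\<close> over \<open>t \<ge> s\<close>, so Tonelli reduces the shell
  integral to volumes of balls.
\<close>

lemma nn_integral_kernel_shell:
  fixes x :: "'a::euclidean_space"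
  assumes r: "0 < r" "r \<le> R"
  shows "(\<integral>\<^sup>+y. kernel {r..<R} x y \<partial>lebesgue) =
    ennreal (real DIM('a) * measure lebesgue (ball (0::'a) 1) * ln (R / r))"
proof -
  define d where "d = DIM('a)"
  define w where "w = measure lebesgue (ball (0::'a) 1)"
  have d: "0 < d" by (simp add: d_def)
  have w: "w = unit_ball_vol d" "0 \<le> w"
    using content_ball[of 1 "0::'a"] by (auto simp: w_def d_def)
  have R: "0 < R" using r by simp
  define f where "f t = real d / t ^ Suc d" for t :: real
  have f_meas [measurable]: "f \<in> borel_measurable borel" unfolding f_def by measurable
  have f_nonneg: "0 \<le> f t" if "0 < t" for t using that by (simp add: f_def)
  have f_deriv: "((\<lambda>t. - 1 / t ^ d) has_real_derivative f t) (at t)" if t: "0 < t" for t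
  proof -
    obtain m where m: "d = Suc m" using d by (cases d) auto
    have "((\<lambda>t. t ^ d) has_real_derivative real d * t ^ m) (at t)"
      using DERIV_pow[of d t] by (simp add: m)
    from DERIV_minus[OF DERIV_inverse'[OF this]]
    have "((\<lambda>t. - 1 / t ^ d) has_real_derivative
        inverse (t ^ d) * (real d * t ^ m) * inverse (t ^ d)) (at t)"
      using t by (simp add: divide_inverse)
    also have "inverse (t ^ d) * (real d * t ^ m) * inverse (t ^ d) = f t"
      using t by (simp add: f_def m field_simps)
    finally show ?thesis .
  qed
  have layer: "ennreal (1 / s ^ d) = (\<integral>\<^sup>+t. ennreal (f t) * indicator {s..} t \<partial>lborel)" if s: "0 < s" for s
  proof -
    have "(\<integral>\<^sup>+t. ennreal (f t) * indicator {s..} t \<partial>lborel) = 0 - (- 1 / s ^ d)"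
    proof (rule nn_integral_FTC_atLeast)
      fix t assume "s \<le> t"
      then have t: "0 < t" using s by simp
      show "((\<lambda>t. - 1 / t ^ d) has_real_derivative f t) (at t)" using f_deriv[OF t] .
      show "0 \<le> f t" using f_nonneg[OF t] .
    next
      show "((\<lambda>t::real. - 1 / t ^ d) \<longlongrightarrow> 0) at_top"
        using filterlim_pow_at_top[OF d filterlim_ident, THEN filterlim_at_top_imp_at_infinity]
        by (rule tendsto_divide_0[OF tendsto_const])
    qed measurable
    then show ?thesis by simp
  qed
  \<comment> \<open>For \<open>t\<close> at least \<open>r\<close>, this is the volume of the part
    of the shell within distance \<open>t\<close> of \<open>x\<close>; it stops growing at
    \<open>t = R\<close>.\<close>
  define v where "v t = w * (min t R ^ d - r ^ d)" for t
  have v_meas [measurable]: "v \<in> borel_measurable borel" unfolding v_def by measurable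
  have shell_meas: "(\<lambda>y. indicator {r..<R} (dist x y) * indicator {dist x y..} t :: ennreal)
      \<in> borel_measurable lborel" for t
  proof -
    have "indicator {dist x y..} t = (indicator {..t} (dist x y) :: ennreal)" for y
      by (simp add: indicator_def)
    then show ?thesis by simp
  qed
  have shell_volume: "(\<integral>\<^sup>+y. indicator {r..<R} (dist x y) * indicator {dist x y..} t \<partial>lborel)
      = ennreal (v t) * indicator {r..} t" for t
  proof (cases "r \<le> t")
    case True
    \<comment> \<open>Below \<open>R\<close> the binding condition is
      \<open>dist x y \<le> t\<close>, a closed ball; from \<open>R\<close> on it is
      \<open>dist x y < R\<close>, an open ball.\<close>
    define C where "C = (if t < R then cball x t else ball x R)"
    have C: "C \<in> sets borel" "emeasure lborel C = ennreal (w * min t R ^ d)" "ball x r \<subseteq> C"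
      using True r by (auto simp: C_def emeasure_ball emeasure_cball w d_def min_def)
    have "(\<integral>\<^sup>+y. indicator {r..<R} (dist x y) * indicator {dist x y..} t \<partial>lborel)
        = (\<integral>\<^sup>+y. indicator (C - ball x r) y \<partial>lborel)"
      by (intro nn_integral_cong) (auto simp: indicator_def C_def)
    also have "\<dots> = emeasure lborel C - emeasure lborel (ball x r)"
      using C r by (simp add: emeasure_Diff emeasure_ball)
    also have "\<dots> = ennreal (v t)"
      using r w by (simp add: C emeasure_ball v_def d_def ennreal_minus algebra_simps)
    finally show ?thesis using True by simp
  next
    case False
    then have "(\<integral>\<^sup>+y. indicator {r..<R} (dist x y) * indicator {dist x y..} t \<partial>lborel)
        = (\<integral>\<^sup>+y. 0 \<partial>(lborel :: 'a measure))"
      by (intro nn_integral_cong) (auto simp: indicator_def)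
    then show ?thesis using False by simp
  qed
  have "kernel {r..<R} x y =
      (\<integral>\<^sup>+t. ennreal (f t) * (indicator {r..<R} (dist x y) * indicator {dist x y..} t) \<partial>lborel)" for y
  proof (cases "dist x y \<in> {r..<R}")
    case True
    then have "0 < dist x y" using r by auto
    from layer[OF this] True show ?thesis by (simp add: kernel_def dist_norm d_def)
  qed (simp add: kernel_def)
  then have "(\<integral>\<^sup>+y. kernel {r..<R} x y \<partial>lebesgue) = (\<integral>\<^sup>+y. \<integral>\<^sup>+t. ennreal (f t) *
      (indicator {r..<R} (dist x y) * indicator {dist x y..} t) \<partial>lborel \<partial>lborel)"
    by (simp add: nn_integral_completion)
  also have "\<dots> = (\<integral>\<^sup>+t. \<integral>\<^sup>+y. ennreal (f t) *
      (indicator {r..<R} (dist x y) * indicator {dist x y..} t) \<partial>lborel \<partial>lborel)"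
  proof (rule lborel_pair.Fubini')
    \<comment> \<open>The set \<open>{dist x y..}\<close> depends on \<open>y\<close>; writing its
      indicator as a conditional exposes joint measurability in \<open>t\<close> and
      \<open>y\<close>.\<close>
    have "(\<lambda>(t, y). ennreal (f t) * (indicator {r..<R} (dist x y) *
        (if dist x y \<le> t then 1 else 0))) \<in> borel_measurable (lborel \<Otimes>\<^sub>M lborel)"
      by measurable
    then show "(\<lambda>(t, y). ennreal (f t) * (indicator {r..<R} (dist x y) * indicator {dist x y..} t))
        \<in> borel_measurable (lborel \<Otimes>\<^sub>M lborel)"
      by (simp add: indicator_def[of "{_..}"])
  qed
  also have "\<dots> = (\<integral>\<^sup>+t. ennreal (f t) * (ennreal (v t) * indicator {r..} t) \<partial>lborel)"
    by (intro nn_integral_cong) (simp add: nn_integral_cmult[OF shell_meas] shell_volume)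
  \<comment> \<open>Beyond \<open>R\<close> the volume is constant, so that part is a multiple of
    the layer integral from \<open>R\<close>. Both indicators contain \<open>R\<close>, hence
    equality is claimed only off this null set.\<close>
  also have "\<dots> = (\<integral>\<^sup>+t. ennreal (f t * v t) * indicator {r..R} t
      + ennreal (w * (R ^ d - r ^ d)) * (ennreal (f t) * indicator {R..} t) \<partial>lborel)"
  proof (intro nn_integral_cong_AE eventually_mono[OF AE_lborel_singleton[of R]])
    fix t :: real assume "t \<noteq> R"
    then consider "t < r" | "r \<le> t" "t < R" | "R < t" by fastforce
    then show "ennreal (f t) * (ennreal (v t) * indicator {r..} t) =
        ennreal (f t * v t) * indicator {r..R} t
        + ennreal (w * (R ^ d - r ^ d)) * (ennreal (f t) * indicator {R..} t)"
      using r f_nonneg[of t] by cases (simp_all add: v_def ennreal_mult' mult.commute)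
  qed
  also have "\<dots> = (\<integral>\<^sup>+t. ennreal (f t * v t) * indicator {r..R} t \<partial>lborel)
      + ennreal (w * (R ^ d - r ^ d)) * ennreal (1 / R ^ d)"
    unfolding layer[OF R] by (subst nn_integral_add) (measurable, subst nn_integral_cmult, measurable)
  also have "(\<integral>\<^sup>+t. ennreal (f t * v t) * indicator {r..R} t \<partial>lborel) =
      ennreal (w * (real d * ln R + r ^ d / R ^ d) - w * (real d * ln r + r ^ d / r ^ d))"
  \<comment> \<open>On this interval \<open>f t * v t\<close> is \<open>w\<close> times
    \<open>d / t - d * r ^ d / t ^ Suc d\<close>, which yields the logarithm and the power in
    \<open>F\<close>.\<close>
  proof (rule nn_integral_FTC_Icc[where F = "\<lambda>t. w * (real d * ln t + r ^ d / t ^ d)"])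
    fix t assume "t \<in> {r..R}"
    then have t: "r \<le> t" "t \<le> R" and t0: "0 < t" using r by auto
    have "((\<lambda>t. w * (real d * ln t + - (r ^ d) * (- 1 / t ^ d))) has_real_derivative
        w * (real d * (1 / t) + - (r ^ d) * f t)) (at t)"
      by (intro DERIV_cmult DERIV_add f_deriv t0 DERIV_ln_divide)
    moreover have "w * (real d * (1 / t) + - (r ^ d) * f t) = f t * v t"
      using t t0 by (simp add: f_def v_def field_simps)
    ultimately show "((\<lambda>t. w * (real d * ln t + r ^ d / t ^ d)) has_real_derivative f t * v t) (at t)"
      by simp
    show "0 \<le> f t * v t"
      using t r w f_nonneg[OF t0] by (simp add: v_def power_mono)
  qed (use r in auto)
  also have "\<dots> + ennreal (w * (R ^ d - r ^ d)) * ennreal (1 / R ^ d) = ennreal (real d * w * ln (R / r))"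
  proof -
    \<comment> \<open>The terms in \<open>q\<close> cancel between the two summands. Adding them
      inside \<open>ennreal\<close> needs each to be nonnegative; for the first this is
      \<open>ln q \<le> q - 1\<close>.\<close>
    define q where "q = r ^ d / R ^ d"
    have q: "0 < q" "r ^ d = q * R ^ d" using r R by (auto simp: q_def)
    have ln_q: "ln q = - (real d * ln (R / r))"
      using r R by (simp add: q_def ln_div ln_realpow algebra_simps)
    have F: "w * (real d * ln R + r ^ d / R ^ d) - w * (real d * ln r + r ^ d / r ^ d)
        = w * (real d * ln (R / r) + q - 1)"
      using r R by (simp add: q_def[symmetric] ln_div algebra_simps)
    have rest: "w * (R ^ d - r ^ d) * (1 / R ^ d) = w * (1 - q)"
      using R by (simp add: q(2) field_simps)
    have nonneg: "0 \<le> w * (real d * ln (R / r) + q - 1)"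
      using ln_le_minus_one[OF q(1)] w(2) unfolding ln_q by (intro mult_nonneg_nonneg) auto
    have "ennreal (w * (R ^ d - r ^ d)) * ennreal (1 / R ^ d) = ennreal (w * (1 - q))"
      unfolding rest[symmetric] using R by (intro ennreal_mult''[symmetric]) simp
    moreover have "0 \<le> w * (1 - q)"
      using r R w(2) by (auto simp: q_def power_mono)
    moreover have "w * (real d * ln (R / r) + q - 1) + w * (1 - q) = real d * w * ln (R / r)"
      by (simp add: algebra_simps)
    ultimately show ?thesis
      unfolding F using nonneg by (simp flip: ennreal_plus)
  qed
  finally show ?thesis by (simp add: d_def w_def)
qed

section \<open>Shells and tails for sets of finite measure\<close>

text \<open>Against the whole space the inner integral does not depend on \<open>x\<close>; the
  value is exactly the change of the logarithmic correction between \<open>r\<close> and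
  \<open>R\<close>.\<close>

lemma interaction_shell_UNIV:
  assumes r: "0 < r" "r \<le> R" and A: "A \<in> lmeasurable"
  shows "interaction {r..<R} A (UNIV :: 'a::euclidean_space set) =
    ennreal (real DIM('a) * measure lebesgue (ball (0::'a) 1) * ln (R / r) * measure lebesgue A)"
proof -
  have "interaction {r..<R} A (UNIV :: 'a set) =
      ennreal (real DIM('a) * measure lebesgue (ball (0::'a) 1) * ln (R / r)) * emeasure lebesgue A"
    using A by (simp add: interaction_def nn_integral_kernel_shell[OF r] nn_integral_cmult_indicator
        fmeasurableD del: emeasure_completion)
  also have "emeasure lebesgue A = ennreal (measure lebesgue A)"
    using A by (simp add: emeasure_eq_measure2 del: emeasure_completion)
  finally show ?thesis
    using r by (simp add: ennreal_mult')
qed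

text \<open>Finiteness allows shell terms to be treated as real numbers, in which the cancellations
  take place.\<close>

lemma interaction_shell_finite:
  assumes "0 < r" "r \<le> R" "A \<in> lmeasurable"
  shows "interaction {r..<R} A B < \<infinity>"
proof -
  have "interaction {r..<R} A B \<le> interaction {r..<R} A UNIV"
    by (rule interaction_mono) auto
  then show ?thesis
    using interaction_shell_UNIV[OF assms] by (simp add: le_less_trans)
qed

lemma interaction_tail_bound:
  assumes "0 < r" "A \<in> lmeasurable" "B \<in> lmeasurable"
  shows "interaction {r..} A (B :: 'a::euclidean_space set) \<le>
    ennreal (1 / r ^ DIM('a) * measure lebesgue A * measure lebesgue B)"
proof -
  have "emeasure lebesgue A = ennreal (measure lebesgue A)"
    "emeasure lebesgue B = ennreal (measure lebesgue B)"
    using assms by (simp_all add: emeasure_eq_measure2 del: emeasure_completion)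
  moreover have "ennreal (1 / r ^ DIM('a) * measure lebesgue A * measure lebesgue B) =
      ennreal (1 / r ^ DIM('a)) * ennreal (measure lebesgue A) * ennreal (measure lebesgue B)"
    using \<open>0 < r\<close> by (subst ennreal_mult; (subst ennreal_mult)?) auto
  ultimately show ?thesis
    using interaction_le[of r "{r..}" A B] assms
    by (simp only: fmeasurableD order_refl)
qed

section \<open>Comparison of radii and the pointwise limit\<close>

text \<open>From \<open>r\<close> to \<open>R\<close>, \<open>H0\<close> gains the shell interaction
  \<open>a\<close> with the complement, while the correction subtracts the full shell
  \<open>a + b\<close>. The net loss is the interaction \<open>b\<close> of \<open>E\<close> with
  itself.\<close>

lemma H0_hat_shell:
  fixes E :: "'a::euclidean_space set"
  assumes r: "0 < r" "r \<le> R" and E: "E \<in> lmeasurable"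
  shows "H0_hat r E = H0_hat R E + enn2ereal (interaction {r..<R} E E)"
proof -
  define c where "c = real DIM('a) * measure lebesgue (ball (0::'a) 1)"
  define m where "m = measure lebesgue E"
  note [simp] = fmeasurableD[OF E] Compl_in_sets_lebesgue
  obtain a where a: "0 \<le> a" "interaction {r..<R} E (- E) = ennreal a"
    using interaction_shell_finite[OF r E, of "- E"] by (cases "interaction {r..<R} E (- E)") auto
  obtain b where b: "0 \<le> b" "interaction {r..<R} E E = ennreal b"
    using interaction_shell_finite[OF r E, of E] by (cases "interaction {r..<R} E E") auto
  have "interaction {r..<R} E (- E \<union> E) = ennreal a + ennreal b"
    by (subst interaction_Un_right) (auto simp: a b)
  then have "ennreal (a + b) = ennreal (c * ln (R / r) * m)"
    using interaction_shell_UNIV[OF r E] a b by (simp add: c_def m_def)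
  moreover have "0 \<le> c * ln (R / r) * m"
    using r by (simp add: c_def m_def)
  ultimately have "a + b = c * ln (R / r) * m"
    using a b by (subst (asm) ennreal_inj) auto
  then have ab: "a + b = c * ln R * m - c * ln r * m"
    using r by (simp add: ln_div algebra_simps)
  have split: "{..<R} = {..<r} \<union> {r..<R}" using r by auto
  have "interaction {..<R} E (- E) = interaction {..<r} E (- E) + interaction {r..<R} E (- E)"
    unfolding split by (rule interaction_Un_distance) auto
  then have H: "H0 R E = H0 r E + ereal a"
    using a by (simp add: H0_eq_interaction plus_ennreal.rep_eq)
  \<comment> \<open>If \<open>H0 r E\<close> is infinite, both sides are infinite; otherwise the
    claim reduces to \<open>ab\<close>.\<close>
  have "H0 r E \<noteq> - \<infinity>" by (simp add: H0_eq_interaction)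
  then show ?thesis
    unfolding H0_hat_def H c_def[symmetric] m_def[symmetric] b(2)
    using ab b by (cases "H0 r E") (auto simp: algebra_simps)
qed

text \<open>At radius 1 the logarithm vanishes, so the shell identity compares \<open>H0 1 E\<close>
  with \<open>H0_hat R E\<close>. Cutting the tail in \<open>J0 1 E\<close> at \<open>R\<close>
  cancels the shell and leaves only the part beyond \<open>R\<close>.\<close>

lemma H0_hat_eq_lim_plus_tail:
  fixes E :: "'a::euclidean_space set"
  assumes R: "1 \<le> R" and E: "E \<in> lmeasurable"
  shows "H0_hat R E = H0_hat_lim E + enn2ereal (interaction {R..} E E)"
proof -
  have fin: "interaction {s..} E E < \<infinity>" if "1 \<le> s" for s
    using interaction_tail_bound[of s E E] that E by (auto intro: le_less_trans)
  obtain b where b: "0 \<le> b" "interaction {1..<R} E E = ennreal b"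
    using interaction_shell_finite[of 1 R E E] R E by (cases "interaction {1..<R} E E") auto
  obtain t where t: "0 \<le> t" "interaction {R..} E E = ennreal t"
    using fin[OF R] by (cases "interaction {R..} E E") auto
  have "{1..} = {1..<R} \<union> {R..}" using R by auto
  then have "interaction {1..} E E = interaction {1..<R} E E + interaction {R..} E E"
    using E by (subst interaction_Un_distance[symmetric]) (auto simp: fmeasurableD)
  then have J: "J0 1 E = ereal (- (b + t))"
    using b t by (simp add: J0_eq_interaction flip: ennreal_plus)
  have "H0 1 E = H0_hat R E + ereal b"
    using H0_hat_shell[of 1 R E] R E b by (simp add: H0_hat_def)
  then show ?thesis
    unfolding H0_hat_lim_def J using t by (cases "H0_hat R E") auto
qed

lemma H0_hat_ge_lim:
  "1 \<le> R \<Longrightarrow> E \<in> lmeasurable \<Longrightarrow> H0_hat_lim E \<le> H0_hat R E"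
  by (simp add: H0_hat_eq_lim_plus_tail ereal_le_add_self)

lemma H0_hat_tendsto:
  fixes E :: "'a::euclidean_space set"
  assumes E: "E \<in> lmeasurable"
  shows "((\<lambda>R. H0_hat R E) \<longlongrightarrow> H0_hat_lim E) at_top"
proof -
  define m where "m = measure lebesgue E"
  have "((\<lambda>R::real. 1 / R ^ DIM('a)) \<longlongrightarrow> 0) at_top"
    using filterlim_pow_at_top[OF DIM_positive filterlim_ident, THEN filterlim_at_top_imp_at_infinity]
    by (rule tendsto_divide_0[OF tendsto_const])
  then have "((\<lambda>R. ennreal (1 / R ^ DIM('a) * m * m)) \<longlongrightarrow> ennreal (0 * m * m)) at_top"
    by (intro tendsto_ennrealI tendsto_intros)
  moreover have "\<forall>\<^sub>F R in at_top. interaction {R..} E E \<le> ennreal (1 / R ^ DIM('a) * m * m)"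
    using eventually_gt_at_top[of 0]
    by eventually_elim (use interaction_tail_bound[OF _ E E] in \<open>simp add: m_def\<close>)
  ultimately have "((\<lambda>R. interaction {R..} E E) \<longlongrightarrow> 0) at_top"
    by (auto intro: tendsto_sandwich[OF _ _ tendsto_const])
  then have tail: "((\<lambda>R. enn2ereal (interaction {R..} E E)) \<longlongrightarrow> 0) at_top"
    using tendsto_enn2ereal_iff[of "\<lambda>R. interaction {R..} E E" 0 at_top]
    by (simp only: zero_ennreal.rep_eq)
  have "((\<lambda>R. H0_hat_lim E + enn2ereal (interaction {R..} E E)) \<longlongrightarrow> H0_hat_lim E + 0) at_top"
    \<comment> \<open>The constant summand may be infinite; the sum still converges because the tail
      has a finite limit.\<close>
    by (rule tendsto_add_ereal_general[OF _ tendsto_const tail]) simp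
  moreover have "\<forall>\<^sub>F R in at_top. H0_hat_lim E + enn2ereal (interaction {R..} E E) = H0_hat R E"
    using eventually_ge_at_top[of 1]
    by eventually_elim (simp add: H0_hat_eq_lim_plus_tail[OF _ E])
  ultimately have "((\<lambda>R. H0_hat R E) \<longlongrightarrow> H0_hat_lim E + 0) at_top"
    by (rule Lim_transform_eventually)
  then show ?thesis by simp
qed

section \<open>Stability under changes of the set and lower semicontinuity\<close>

text \<open>Points of \<open>E - F\<close> cost at most a full shell each. For points of
  \<open>E \<inter> F\<close>, partners in \<open>F - E\<close> are controlled by the bounded
  kernel, and partners outside both sets already count for \<open>F\<close>. Truncating only the
  side of \<open>E\<close> suffices for a lower bound on the energy of \<open>F\<close>.\<close>

lemma interaction_compl_le:
  fixes E F :: "'a::euclidean_space set"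
  assumes \<epsilon>: "0 < \<epsilon>" "\<epsilon> \<le> 1" and E: "E \<in> lmeasurable" and F: "F \<in> lmeasurable"
  shows "interaction {\<epsilon>..<1} E (- E) \<le> interaction {..<1} F (- F)
    + ennreal (real DIM('a) * measure lebesgue (ball (0::'a) 1) * ln (1 / \<epsilon>) * measure lebesgue (E - F)
      + 1 / \<epsilon> ^ DIM('a) * measure lebesgue E * measure lebesgue (F - E))"
proof -
  let ?I = "interaction {\<epsilon>..<1}"
  note [simp] = fmeasurableD[OF E] fmeasurableD[OF F] Compl_in_sets_lebesgue
  have FE: "F - E \<in> lmeasurable" and EF: "E - F \<in> lmeasurable"
    using E F by (auto intro: fmeasurable_Diff)
  have "?I E (- E) = ?I ((E - F) \<union> (E \<inter> F)) (- E)"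
    by (simp add: Un_Diff_Int)
  also have "\<dots> = ?I (E - F) (- E) + ?I (E \<inter> F) (- E)"
    by (rule interaction_Un_left) auto
  also have "?I (E \<inter> F) (- E) = ?I (E \<inter> F) ((F - E) \<union> (- E \<inter> - F))"
    by (rule arg_cong[where f = "?I _"]) auto
  also have "\<dots> = ?I (E \<inter> F) (F - E) + ?I (E \<inter> F) (- E \<inter> - F)"
    by (rule interaction_Un_right) auto
  also have "?I (E - F) (- E) \<le> ?I (E - F) UNIV"
    by (rule interaction_mono) auto
  also have "?I (E \<inter> F) (F - E) \<le> interaction {\<epsilon>..} E (F - E)"
    by (rule interaction_mono) auto
  also have "?I (E \<inter> F) (- E \<inter> - F) \<le> interaction {..<1} F (- F)"
    by (rule interaction_mono) auto
  also note interaction_shell_UNIV[OF \<epsilon> EF]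
  also note interaction_tail_bound[OF \<epsilon>(1) E FE]
  finally show ?thesis
    using \<epsilon> by (subst ennreal_plus) (auto simp: add_ac)
qed

text \<open>A pair in \<open>F\<close> that is not a pair in \<open>E\<close> has a point in
  \<open>F - E\<close>, and the kernel is at most 1 at distances at least 1. An upper bound is the
  useful direction, since the tail enters \<open>J0\<close> with a minus sign.\<close>

lemma interaction_tail_le:
  fixes E F :: "'a::euclidean_space set"
  assumes E: "E \<in> lmeasurable" and F: "F \<in> lmeasurable"
  shows "interaction {1..} F F \<le> interaction {1..} E E
    + ennreal (measure lebesgue (F - E) * (measure lebesgue E + measure lebesgue F))"
proof -
  let ?I = "interaction {1..}"
  note [simp] = fmeasurableD[OF E] fmeasurableD[OF F] Compl_in_sets_lebesgue
  have FE: "F - E \<in> lmeasurable"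
    using E F by (auto intro: fmeasurable_Diff)
  have "?I F F = ?I ((F - E) \<union> (F \<inter> E)) F"
    by (simp add: Un_Diff_Int)
  also have "\<dots> = ?I (F - E) F + ?I (F \<inter> E) F"
    by (rule interaction_Un_left) auto
  also have "?I (F \<inter> E) F = ?I (F \<inter> E) ((F - E) \<union> (F \<inter> E))"
    by (simp add: Un_Diff_Int)
  also have "\<dots> = ?I (F \<inter> E) (F - E) + ?I (F \<inter> E) (F \<inter> E)"
    by (rule interaction_Un_right) auto
  also have "?I (F \<inter> E) (F - E) \<le> ?I E (F - E)"
    by (rule interaction_mono) auto
  also have "?I (F \<inter> E) (F \<inter> E) \<le> ?I E E"
    by (rule interaction_mono) auto
  also note interaction_tail_bound[OF zero_less_one FE F]
  also note interaction_tail_bound[OF zero_less_one E FE]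
  finally show ?thesis
    by (simp add: add_ac algebra_simps)
qed

lemma incseq_truncation: "incseq (\<lambda>k. {1 / real (Suc k)..<1})"
proof (rule monoI)
  fix m n :: nat assume "m \<le> n"
  then have "1 / real (Suc n) \<le> 1 / real (Suc m)" by (intro frac_le) auto
  then show "{1 / real (Suc m)..<1} \<subseteq> {1 / real (Suc n)..<1}"
    by (meson atLeastLessThan_iff order_trans subsetI)
qed

lemma interaction_truncate_SUP:
  assumes "E \<in> sets lebesgue"
  shows "interaction {..<1} E (- E) = (SUP k. interaction {1 / real (Suc k)..<1} E (- E))"
proof -
  have "(\<Union>k. {1 / real (Suc k)..<1}) = {0<..<1}"
  proof (intro equalityI subsetI)
    fix x :: real assume x: "x \<in> {0<..<1}"
    then obtain k where "inverse (real (Suc k)) < x" using reals_Archimedean by auto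
    with x show "x \<in> (\<Union>k. {1 / real (Suc k)..<1})" by (auto simp: inverse_eq_divide intro!: exI[of _ k])
  next
    fix x :: real assume "x \<in> (\<Union>k. {1 / real (Suc k)..<1})"
    then obtain k where "1 / real (Suc k) \<le> x" "x < 1" by auto
    moreover have "0 < 1 / real (Suc k)" by simp
    ultimately show "x \<in> {0<..<1}"
      unfolding greaterThanLessThan_iff by linarith
  qed
  \<comment> \<open>The truncations never reach distance 0; nothing is lost, since the kernel is 0
    there and distances are not negative.\<close>
  moreover have "kernel {..<1} = (kernel {0<..<1} :: 'a \<Rightarrow> 'a \<Rightarrow> _)"
    by (auto simp: fun_eq_iff kernel_def indicator_def)
  then have "interaction {..<1} E (- E) = interaction {0<..<1} E (- E)"
    by (simp add: interaction_def)
  ultimately show ?thesis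
    using interaction_distance_SUP[of "\<lambda>k. {1 / real (Suc k)..<1}" E "- E"] assms
    by (simp add: incseq_truncation Compl_in_sets_lebesgue del: of_nat_Suc)
qed

lemma char_L1_conv_measure_sym_diff:
  assumes u: "\<And>n. u n \<in> lmeasurable" and E: "E \<in> lmeasurable" and conv: "char_L1_conv u E"
  shows "(\<lambda>n. measure lebesgue (sym_diff (u n) E)) \<longlonglongrightarrow> 0"
proof -
  have sd: "sym_diff (u n) E \<in> lmeasurable" for n
    using u E by (auto intro: fmeasurable_Diff fmeasurable.Un)
  have "(\<integral>\<^sup>+x. ennreal \<bar>indicat_real (u n) x - indicat_real E x\<bar> \<partial>lebesgue) =
      ennreal (measure lebesgue (sym_diff (u n) E))" for n
  proof -
    have "(\<integral>\<^sup>+x. ennreal \<bar>indicat_real (u n) x - indicat_real E x\<bar> \<partial>lebesgue) =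
        (\<integral>\<^sup>+x. indicator (sym_diff (u n) E) x \<partial>lebesgue)"
      by (intro nn_integral_cong) (auto simp: indicator_def)
    then show ?thesis
      using sd[of n] by (simp add: fmeasurableD emeasure_eq_measure2 del: emeasure_completion)
  qed
  then have "(\<lambda>n. ennreal (measure lebesgue (sym_diff (u n) E))) \<longlonglongrightarrow> ennreal 0"
    using conv by (simp add: char_L1_conv_def)
  then show ?thesis
    by (rule tendsto_ennrealD) auto
qed

text \<open>For each fixed cutoff the stability errors vanish as \<open>n\<close> grows, so the
  truncated energy of \<open>E\<close> bounds the liminf from below. Only afterwards is the cutoff
  sent to 0.\<close>

lemma H0_hat_lim_le_liminf:
  fixes E :: "'a::euclidean_space set"
  assumes u: "\<And>n. u n \<in> lmeasurable" and E: "E \<in> lmeasurable" and conv: "char_L1_conv u E"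
  shows "H0_hat_lim E \<le> liminf (\<lambda>n. H0_hat_lim (u n))"
proof -
  define m where "m = measure lebesgue E"
  define \<delta> where "\<delta> n = measure lebesgue (sym_diff (u n) E)" for n
  have \<delta>: "\<delta> \<longlonglongrightarrow> 0"
    unfolding \<delta>_def by (rule char_L1_conv_measure_sym_diff[OF u E conv])
  have sd: "sym_diff (u n) E \<in> lmeasurable" for n
    using u E by (auto intro: fmeasurable_Diff fmeasurable.Un)
  have le_\<delta>: "measure lebesgue (E - u n) \<le> \<delta> n" "measure lebesgue (u n - E) \<le> \<delta> n" for n
    unfolding \<delta>_def using u E by (auto intro!: measure_mono_fmeasurable sd fmeasurableD fmeasurable_Diff)
  have u_le: "measure lebesgue (u n) \<le> m + \<delta> n" for n
  proof -
    have "measure lebesgue (u n) \<le> measure lebesgue (E \<union> (u n - E))"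
      using u E by (intro measure_mono_fmeasurable) (auto intro: fmeasurableD fmeasurable_Diff)
    also have "\<dots> \<le> m + measure lebesgue (u n - E)"
      unfolding m_def using u E by (intro measure_Un_le) (auto intro: fmeasurableD)
    finally show ?thesis using le_\<delta>(2)[of n] by simp
  qed
  have fin: "interaction {1..} A A < \<infinity>" if "A \<in> lmeasurable" for A :: "'a set"
    using interaction_tail_bound[of 1 A A] that by (auto intro: le_less_trans)
  obtain W where W: "0 \<le> W" "interaction {1..} E E = ennreal W"
    using fin[OF E] by (cases "interaction {1..} E E") auto
  have truncated: "enn2ereal (interaction {\<epsilon>..<1} E (- E)) + ereal (- W)
      \<le> liminf (\<lambda>n. H0_hat_lim (u n))" if \<epsilon>: "0 < \<epsilon>" "\<epsilon> \<le> 1" for \<epsilon>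
  proof -
    define K where "K = real DIM('a) * measure lebesgue (ball (0::'a) 1) * ln (1 / \<epsilon>)"
    define L where "L = 1 / \<epsilon> ^ DIM('a) * m"
    \<comment> \<open>The first two terms bound the error for the complement; the last bounds the
      tail error, using \<open>m + \<delta> n\<close> as a bound for the measure of
      \<open>u n\<close>.\<close>
    define err where "err n = K * \<delta> n + L * \<delta> n + \<delta> n * (m + (m + \<delta> n))" for n
    have KL: "0 \<le> K" "0 \<le> L" "0 \<le> m" using \<epsilon> by (auto simp: K_def L_def m_def)
    obtain e where e: "0 \<le> e" "interaction {\<epsilon>..<1} E (- E) = ennreal e"
      using interaction_shell_finite[OF \<epsilon> E, of "- E"] by (cases "interaction {\<epsilon>..<1} E (- E)") auto
    have "ereal (e - W - err n) \<le> H0_hat_lim (u n)" for n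
    proof -
      obtain w where w: "0 \<le> w" "interaction {1..} (u n) (u n) = ennreal w"
        using fin[OF u[of n]] by (cases "interaction {1..} (u n) (u n)") auto
      define p q where "p = K * measure lebesgue (E - u n) + L * measure lebesgue (u n - E)"
        and "q = measure lebesgue (u n - E) * (m + measure lebesgue (u n))"
      have pq: "0 \<le> p" "0 \<le> q" using KL by (auto simp: p_def q_def)
      have "p \<le> K * \<delta> n + L * \<delta> n"
        unfolding p_def using KL le_\<delta> by (intro add_mono mult_left_mono)
      moreover have "q \<le> \<delta> n * (m + (m + \<delta> n))"
        unfolding q_def using KL le_\<delta> u_le by (intro mult_mono add_mono) (auto simp: \<delta>_def)
      ultimately have err: "p + q \<le> err n" by (simp add: err_def)
      have "ennreal w \<le> ennreal (W + q)"
        using interaction_tail_le[OF E u[of n]] W w pq by (simp add: q_def m_def)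
      then have w_le: "w \<le> W + q" using W pq by (subst (asm) ennreal_le_iff) auto
      have "ennreal e \<le> interaction {..<1} (u n) (- u n) + ennreal p"
        using interaction_compl_le[OF \<epsilon> E u[of n]] e by (simp add: p_def K_def L_def m_def)
      then have "ereal e \<le> H0 1 (u n) + ereal p"
        using e(1) pq by (simp add: less_eq_ennreal.rep_eq plus_ennreal.rep_eq H0_eq_interaction)
      then show ?thesis
        using w_le err w by (cases "H0 1 (u n)") (auto simp: H0_hat_lim_def J0_eq_interaction)
    qed
    then have "liminf (\<lambda>n. ereal (e - W - err n)) \<le> liminf (\<lambda>n. H0_hat_lim (u n))"
      by (intro Liminf_mono always_eventually allI)
    \<comment> \<open>The limit keeps the shape of \<open>err\<close> with 0 in place of
      \<open>\<delta> n\<close>, so that the limit rules match term by term.\<close>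
    moreover have "(\<lambda>n. ereal (e - W - err n)) \<longlonglongrightarrow> ereal (e - W - (K * 0 + L * 0 + 0 * (m + (m + 0))))"
      unfolding err_def by (intro tendsto_intros \<delta>)
    from lim_imp_Liminf[OF _ this] have "liminf (\<lambda>n. ereal (e - W - err n)) = ereal (e - W)"
      by simp
    ultimately show ?thesis using e by simp
  qed
  have "incseq (\<lambda>k. interaction {1 / real (Suc k)..<1} E (- E))"
    using incseq_truncation by (auto simp only: incseq_def intro!: interaction_mono order_refl)
  from LIMSEQ_SUP[OF this]
  have "(\<lambda>k. enn2ereal (interaction {1 / real (Suc k)..<1} E (- E))) \<longlonglongrightarrow> H0 1 E"
    using E by (simp add: H0_eq_interaction interaction_truncate_SUP fmeasurableD)
  then have "(\<lambda>k. enn2ereal (interaction {1 / real (Suc k)..<1} E (- E)) + ereal (- W))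
      \<longlonglongrightarrow> H0 1 E + ereal (- W)"
    \<comment> \<open>Here too \<open>H0 1 E\<close> may be infinite; the added tail
      \<open>- W\<close> is a real constant.\<close>
    by (intro tendsto_cadd_ereal) (auto simp: H0_eq_interaction)
  then have "H0 1 E + ereal (- W) \<le> liminf (\<lambda>n. H0_hat_lim (u n))"
    by (rule LIMSEQ_le_const2) (auto intro!: truncated)
  then show ?thesis
    using W by (simp add: H0_hat_lim_def J0_eq_interaction)
qed

theorem proposition2p3:
  shows "(\<forall>E \<in> (lmeasurable :: 'a::euclidean_space set set).
            antimono_on {0<..} (\<lambda>R. H0_hat R E) \<and>
            ((\<lambda>R. H0_hat R E) \<longlongrightarrow> H0_hat_lim E) at_top) \<and>
         Gamma_limit_at_top (lmeasurable :: 'a set set) char_L1_conv H0_hat H0_hat_lim"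
proof (intro conjI ballI)
  fix E :: "'a set" assume E: "E \<in> lmeasurable"
  show "antimono_on {0<..} (\<lambda>R. H0_hat R E)"
    using E by (auto intro!: monotone_onI simp: H0_hat_shell[of _ _ E] ereal_le_add_self)
  show "((\<lambda>R. H0_hat R E) \<longlongrightarrow> H0_hat_lim E) at_top"
    by (rule H0_hat_tendsto[OF E])
next
  show "Gamma_limit_at_top (lmeasurable :: 'a set set) char_L1_conv H0_hat H0_hat_lim"
    unfolding Gamma_limit_at_top_def
  proof (intro allI impI conjI ballI; (elim conjE)?)
    fix r :: "nat \<Rightarrow> real" and u and E :: "'a set"
    assume r: "filterlim r at_top sequentially" and u: "\<forall>n. u n \<in> lmeasurable"
      and E: "E \<in> lmeasurable" and conv: "char_L1_conv u E"
    \<comment> \<open>The comparison \<open>H0_hat_ge_lim\<close> is available from radius 1 on; a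
      liminf sees only the indices beyond that point.\<close>
    have "\<forall>\<^sub>F n in sequentially. 1 \<le> r n"
      using r by (simp add: filterlim_at_top)
    then have "\<forall>\<^sub>F n in sequentially. H0_hat_lim (u n) \<le> H0_hat (r n) (u n)"
      by eventually_elim (use u in \<open>auto intro: H0_hat_ge_lim\<close>)
    then have "liminf (\<lambda>n. H0_hat_lim (u n)) \<le> liminf (\<lambda>n. H0_hat (r n) (u n))"
      by (rule Liminf_mono)
    then show "H0_hat_lim E \<le> liminf (\<lambda>n. H0_hat (r n) (u n))"
      using H0_hat_lim_le_liminf[of u E] u E conv by (auto intro: order_trans)
  next
    fix r :: "nat \<Rightarrow> real" and E :: "'a set"
    assume r: "filterlim r at_top sequentially" and E: "E \<in> lmeasurable"
    have "(\<lambda>n. H0_hat (r n) E) \<longlonglongrightarrow> H0_hat_lim E"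
      using H0_hat_tendsto[OF E] r by (rule filterlim_compose)
    then have "limsup (\<lambda>n. H0_hat (r n) E) = H0_hat_lim E"
      by (intro lim_imp_Limsup) auto
    with E show "\<exists>u. (\<forall>n. u n \<in> lmeasurable) \<and> char_L1_conv u E \<and>
        limsup (\<lambda>n. H0_hat (r n) (u n)) \<le> H0_hat_lim E"
      by (intro exI[of _ "\<lambda>_. E"]) (simp add: char_L1_conv_def)
  qed
qed

end
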